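(* Let $k\ge1$ and let $n$ be the least natural number such that $\binom{n}{\lfloor n/2\rfloor}\ge k$. Then ${\sf IPC}+\varphi_k$ is complete with respect to the class of all finite Brouwer algebras $L$ whose least element $0$ is meet-irreducible and which have at most $n$ coatoms; that is, a formula is derivable in ${\sf IPC}+\varphi_k$ if and only if it is satisfied by every such algebra. Here $\varphi_1=\neg p\vee\neg\neg p$ and, for $k>1$, $\varphi_k=\bigvee_{1\le i,j\le k,\ i\neq j}(\neg p_i\rightarrow\neg p_j)\vee\neg(\neg p_1\wedge\cdots\wedge\neg p_k)$.
   Context: A Brouwer algebra is an algebra $\langle L,+,\times,\rightarrow,\neg,0,1\rangle$ where $\langle L,+,\times,0,1\rangle$ is a bounded distributive lattice ($+$ = join, $\times$ = meet), $\rightarrow$ satisfies $b\le a+c\iff a\rightarrow b\le c$ (i.e. $a\rightarrow b$ is the least $c$ with $b\le a+c$), and $\neg a=a\rightarrow 1$. $L$ satisfies a propositional formula $\sigma$ if every substitution of elements of $L$ for the variables, interpreting $\vee,\wedge,\rightarrow,\neg$ as $\times,+,\rightarrow,\neg$ respectively, yields $0$. A coatom is a maximal element of $L\setminus\{1\}$. ${\sf IPC}+\varphi$ denotes the deductive closure of intuitionistic propositional calculus together with all substitution instances of $\varphi$.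
   Formalization: The number n is taken as the least positive natural number with the stated property; this matters only for k = 1, where n = 0 would leave only the one-element algebra and make the claim false. The algebras have finite carriers inside an arbitrary infinite type, which covers all up to isomorphism. *)

theory Defs
  imports "HOL-Algebra.Lattice" "HOL-Library.Infinite_Typeclass"
begin

section \<open>Propositional formulas and intermediate logics\<close>

datatype form =
    Var nat
  | Neg form
  | Conj form form
  | Disj form form
  | Imp form form

primrec subst :: "(nat \<Rightarrow> form) \<Rightarrow> form \<Rightarrow> form" where
  "subst s (Var i) = s i"
| "subst s (Neg A) = Neg (subst s A)"
| "subst s (Conj A B) = Conj (subst s A) (subst s B)"
| "subst s (Disj A B) = Disj (subst s A) (subst s B)"
| "subst s (Imp A B) = Imp (subst s A) (subst s B)"

text \<open>Derivability from a set of premises in Kleene's Hilbert-style axiomatisation of the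
  intuitionistic propositional calculus, with negation as a primitive connective.\<close>

inductive ipc_derives :: "form set \<Rightarrow> form \<Rightarrow> bool" (infix \<open>\<turnstile>\<^sub>I\<close> 50)
  for \<Gamma> :: "form set" where
  premise: "A \<in> \<Gamma> \<Longrightarrow> \<Gamma> \<turnstile>\<^sub>I A"
| mp: "\<Gamma> \<turnstile>\<^sub>I Imp A B \<Longrightarrow> \<Gamma> \<turnstile>\<^sub>I A \<Longrightarrow> \<Gamma> \<turnstile>\<^sub>I B"
| imp_K: "\<Gamma> \<turnstile>\<^sub>I Imp A (Imp B A)"
| imp_S: "\<Gamma> \<turnstile>\<^sub>I Imp (Imp A (Imp B C)) (Imp (Imp A B) (Imp A C))"
| conjI: "\<Gamma> \<turnstile>\<^sub>I Imp A (Imp B (Conj A B))"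
| conjE1: "\<Gamma> \<turnstile>\<^sub>I Imp (Conj A B) A"
| conjE2: "\<Gamma> \<turnstile>\<^sub>I Imp (Conj A B) B"
| disjI1: "\<Gamma> \<turnstile>\<^sub>I Imp A (Disj A B)"
| disjI2: "\<Gamma> \<turnstile>\<^sub>I Imp B (Disj A B)"
| disjE: "\<Gamma> \<turnstile>\<^sub>I Imp (Imp A C) (Imp (Imp B C) (Imp (Disj A B) C))"
| negI: "\<Gamma> \<turnstile>\<^sub>I Imp (Imp A B) (Imp (Imp A (Neg B)) (Neg A))"
| negE: "\<Gamma> \<turnstile>\<^sub>I Imp (Neg A) (Imp A B)"

definition IPC_plus :: "form \<Rightarrow> form set" where
  "IPC_plus A = {B. range (\<lambda>s. subst s A) \<turnstile>\<^sub>I B}"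

definition phi :: "nat \<Rightarrow> form" where
  "phi k =
    (if k = 1 then Disj (Neg (Var 1)) (Neg (Neg (Var 1)))
     else foldr Disj
       [Imp (Neg (Var i)) (Neg (Var j)). i \<leftarrow> [1..<Suc k], j \<leftarrow> [1..<Suc k], i \<noteq> j]
       (Neg (foldl Conj (Neg (Var 1)) [Neg (Var i). i \<leftarrow> [2..<Suc k]])))"


section \<open>Brouwer algebras\<close>

text \<open>Join, meet, least and greatest element are those determined by the order, as in
  HOL-Algebra.\<close>

record 'a brouwer = "'a gorder" +
  bimp :: "'a \<Rightarrow> 'a \<Rightarrow> 'a" (infixr \<open>\<leadsto>\<index>\<close> 60)
  bneg :: "'a \<Rightarrow> 'a" (\<open>\<sim>\<index> _\<close> [81] 80)

locale brouwer_algebra = bounded_lattice L for L :: "('a, 'b) brouwer_scheme" (structure) +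
  assumes distrib:
      "\<lbrakk>a \<in> carrier L; b \<in> carrier L; c \<in> carrier L\<rbrakk>
        \<Longrightarrow> a \<sqinter> (b \<squnion> c) = (a \<sqinter> b) \<squnion> (a \<sqinter> c)"
    and bimp_closed: "\<lbrakk>a \<in> carrier L; b \<in> carrier L\<rbrakk> \<Longrightarrow> (a \<leadsto> b) \<in> carrier L"
    and bimp_iff:
      "\<lbrakk>a \<in> carrier L; b \<in> carrier L; c \<in> carrier L\<rbrakk>
        \<Longrightarrow> b \<sqsubseteq> a \<squnion> c \<longleftrightarrow> (a \<leadsto> b) \<sqsubseteq> c"
    and bneg_eq: "a \<in> carrier L \<Longrightarrow> (\<sim> a) = (a \<leadsto> \<top>)"

text \<open>The order of a Brouwer algebra is dual to the one of a Heyting algebra: disjunction is the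
  meet, conjunction is the join, and truth is the least element.\<close>

primrec eval :: "('a, 'b) brouwer_scheme \<Rightarrow> (nat \<Rightarrow> 'a) \<Rightarrow> form \<Rightarrow> 'a" where
  "eval L v (Var i) = v i"
| "eval L v (Neg A) = (\<sim>\<^bsub>L\<^esub> (eval L v A))"
| "eval L v (Conj A B) = eval L v A \<squnion>\<^bsub>L\<^esub> eval L v B"
| "eval L v (Disj A B) = eval L v A \<sqinter>\<^bsub>L\<^esub> eval L v B"
| "eval L v (Imp A B) = (eval L v A \<leadsto>\<^bsub>L\<^esub> eval L v B)"

definition satisfies :: "('a, 'b) brouwer_scheme \<Rightarrow> form \<Rightarrow> bool" where
  "satisfies L A \<longleftrightarrow> (\<forall>v. (\<forall>i. v i \<in> carrier L) \<longrightarrow> eval L v A = \<bottom>\<^bsub>L\<^esub>)"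

definition coatoms :: "('a, 'b) gorder_scheme \<Rightarrow> 'a set" where
  "coatoms L = {x \<in> carrier L - {\<top>\<^bsub>L\<^esub>}. \<forall>y \<in> carrier L - {\<top>\<^bsub>L\<^esub>}. x \<sqsubseteq>\<^bsub>L\<^esub> y \<longrightarrow> y = x}"

definition meet_irreducible :: "('a, 'b) gorder_scheme \<Rightarrow> 'a \<Rightarrow> bool" where
  "meet_irreducible L x \<longleftrightarrow>
    (\<forall>a \<in> carrier L. \<forall>b \<in> carrier L. x = a \<sqinter>\<^bsub>L\<^esub> b \<longrightarrow> x = a \<or> x = b)"

end

theory Submission
  imports Defs Complex_Main
begin

text \<open>
  If all disjuncts of \<open>phi k\<close> fail at the root of a finite frame, the sets of maximal points
  forcing the formulas \<open>Neg (Var i)\<close> form an antichain of size \<open>k\<close> with a common point. Deleting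
  that point and applying Sperner's theorem shows that such an antichain exists only if there are
  more than \<open>n\<close> maximal points; algebraically, maximal points are coatoms. Conversely, let \<open>T\<close> be a
  prime theory containing all instances of \<open>phi k\<close> but not \<open>A\<close>. More than \<open>n\<close> complete theories above \<open>T\<close> could
  be separated by formulas, and the \<open>n div 2\<close>-subsets of \<open>n\<close> of them would refute \<open>phi k\<close>. Filtrating
  the prime theories above \<open>T\<close> through the subformulas of \<open>A\<close> gives a finite rooted frame whose
  maximal points all come from complete theories, and its upward closed sets form the algebra
  refuting \<open>A\<close>.
\<close>

section \<open>Sperner's theorem\<close>

definition antichain :: "'a set set \<Rightarrow> bool" where
  "antichain F \<longleftrightarrow> (\<forall>X\<in>F. \<forall>Y\<in>F. X \<subseteq> Y \<longrightarrow> X = Y)"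

text \<open>Averaging over the points \<open>x\<close> of \<open>S\<close> the inequality for the members of \<open>F\<close> that avoid \<open>x\<close>.\<close>

lemma LYM_inequality:
  assumes "finite S" "F \<subseteq> Pow S" "antichain F"
  shows "(\<Sum>X\<in>F. 1 / real (card S choose card X)) \<le> 1"
  using assms
proof (induction "card S" arbitrary: S F)
  case 0
  then have "F = {} \<or> F = {{}}" by auto
  then show ?case using 0 by auto
next
  case (Suc m)
  let ?n = "card S"
  have finF: "finite F" using Suc.prems by (meson finite_Pow_iff finite_subset)
  show ?case
  proof (cases "S \<in> F")
    case True
    then have "F = {S}" using Suc.prems unfolding antichain_def by blast
    then show ?thesis by simp
  next
    case False
    have fin: "finite X" and lt: "card X < ?n" if "X \<in> F" for X
    proof -
      have "X \<subset> S" using that Suc.prems(2) False by blast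
      then show "finite X" "card X < ?n"
        using Suc.prems(1) by (auto intro: finite_subset psubset_card_mono)
    qed
    have IH: "(\<Sum>X\<in>{X\<in>F. x \<notin> X}. 1 / real (m choose card X)) \<le> 1" if "x \<in> S" for x
    proof -
      have "m = card (S - {x})" using that Suc by simp
      then show ?thesis
        using Suc.hyps(1)[of "S - {x}" "{X\<in>F. x \<notin> X}"] Suc.prems
        unfolding antichain_def by auto
    qed
    \<comment> \<open>Each \<open>X\<close> is counted once for every point it avoids; binomial
      absorption turns that total into \<open>?n\<close> times its weight in
      \<open>S\<close>.\<close>
    have weight: "real (card (S - X)) / real (m choose card X) = real ?n / real (?n choose card X)"
      if "X \<in> F" for X
    proof -
      have "card (S - X) = ?n - card X"
        using that Suc.prems fin[OF that] by (auto intro: card_Diff_subset)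
      moreover have "(?n - card X) * (?n choose card X) = ?n * (m choose card X)"
        using binomial_absorb_comp[of ?n "card X"] Suc.hyps(2) by (metis diff_Suc_1)
      then have "real (?n - card X) * real (?n choose card X) = real ?n * real (m choose card X)"
        by (metis of_nat_mult)
      moreover have "m choose card X > 0" "?n choose card X > 0"
        using lt[OF that] Suc.hyps(2) by (simp_all add: zero_less_binomial_iff)
      ultimately show ?thesis by (simp add: field_simps)
    qed
    have "real ?n * (\<Sum>X\<in>F. 1 / real (?n choose card X))
        = (\<Sum>X\<in>F. \<Sum>x\<in>S - X. 1 / real (m choose card X))"
      using weight by (simp add: sum_distrib_left)
    also have "\<dots> = (\<Sum>X\<in>F. \<Sum>x\<in>{x\<in>S. x \<notin> X}. 1 / real (m choose card X))"
      by (simp add: set_diff_eq)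
    also have "\<dots> = (\<Sum>x\<in>S. \<Sum>X\<in>{X\<in>F. x \<notin> X}. 1 / real (m choose card X))"
      by (rule sum.swap_restrict[OF finF Suc.prems(1)])
    also have "\<dots> \<le> (\<Sum>x\<in>S. 1)"
      by (rule sum_mono[OF IH])
    finally have "real ?n * (\<Sum>X\<in>F. 1 / real (?n choose card X)) \<le> real ?n * 1" by simp
    then show ?thesis by (rule mult_left_le_imp_le) (use Suc.hyps(2) in linarith)
  qed
qed

text \<open>The central binomial coefficient is the largest of its row, so each member of
  \<open>F\<close> contributes at least its reciprocal to the LYM sum.\<close>

theorem Sperner:
  assumes "finite S" "F \<subseteq> Pow S" "antichain F"
  shows "card F \<le> card S choose (card S div 2)"
proof -
  let ?c = "real (card S choose (card S div 2))"
  have pos: "?c > 0" by (simp add: zero_less_binomial_iff)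
  have "real (card F) / ?c = (\<Sum>X\<in>F. 1 / ?c)" by simp
  also have "\<dots> \<le> (\<Sum>X\<in>F. 1 / real (card S choose card X))"
  proof (rule sum_mono)
    fix X assume "X \<in> F"
    then have "card X \<le> card S" using assms by (auto intro: card_mono)
    then show "1 / ?c \<le> 1 / real (card S choose card X)"
      using binomial_maximum[of "card S" "card X"] by (intro frac_le) auto
  qed
  also have "\<dots> \<le> 1" by (rule LYM_inequality[OF assms])
  finally show ?thesis using pos by (simp add: field_simps)
qed

section \<open>Soundness\<close>

context brouwer_algebra
begin

section \<open>Order calculus from residuation, and soundness of the calculus\<close>

lemma join_le_iff:
  assumes "x \<in> carrier L" "y \<in> carrier L" "z \<in> carrier L"
  shows "x \<squnion> y \<sqsubseteq> z \<longleftrightarrow> x \<sqsubseteq> z \<and> y \<sqsubseteq> z"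
proof
  assume "x \<squnion> y \<sqsubseteq> z"
  then show "x \<sqsubseteq> z \<and> y \<sqsubseteq> z"
    using le_trans[of x "x \<squnion> y" z] le_trans[of y "x \<squnion> y" z] assms
    by (simp add: join_left join_right)
qed (simp add: join_le assms)

lemma top_le_iff: "x \<in> carrier L \<Longrightarrow> \<top> \<sqsubseteq> x \<longleftrightarrow> x = \<top>"
  using le_antisym[of x \<top>] top_higher[of x] top_closed le_refl by blast

lemma le_bottom_iff: "x \<in> carrier L \<Longrightarrow> x \<sqsubseteq> \<bottom> \<longleftrightarrow> x = \<bottom>"
  using le_antisym[of x \<bottom>] bottom_lower[of x] bottom_closed le_refl by blast

text \<open>By residuation the left side says \<open>b \<sqsubseteq> a \<squnion> x\<close>, and the
  elements above \<open>a \<squnion> x\<close> are those above both \<open>a\<close> and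
  \<open>x\<close>. Reading \<open>a \<sqsubseteq> z\<close> as "\<open>z\<close> forces
  \<open>a\<close>", this is the Kripke clause for implication, so many axioms can be checked
  pointwise.\<close>

lemma bimp_le_iff:
  assumes "a \<in> carrier L" "b \<in> carrier L" "x \<in> carrier L"
  shows "(a \<leadsto> b) \<sqsubseteq> x \<longleftrightarrow> (\<forall>z\<in>carrier L. x \<sqsubseteq> z \<longrightarrow> a \<sqsubseteq> z \<longrightarrow> b \<sqsubseteq> z)"
proof -
  have "b \<sqsubseteq> a \<squnion> x \<longleftrightarrow> (\<forall>z\<in>carrier L. a \<squnion> x \<sqsubseteq> z \<longrightarrow> b \<sqsubseteq> z)"
    using assms le_trans[of b "a \<squnion> x"] by auto
  then show ?thesis using assms bimp_iff[of a b x] by (auto simp: join_le_iff)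
qed

lemma bimp_eq_bottom_iff:
  assumes "a \<in> carrier L" "b \<in> carrier L"
  shows "(a \<leadsto> b) = \<bottom> \<longleftrightarrow> b \<sqsubseteq> a"
proof -
  have "a \<squnion> \<bottom> = a"
    using assms bottom_lower le_iff_meet[of \<bottom> a] join_comm[of L a \<bottom>] by simp
  then show ?thesis
    using assms bimp_iff[of a b \<bottom>] by (simp add: le_bottom_iff bimp_closed)
qed

lemma bneg_closed: "a \<in> carrier L \<Longrightarrow> (\<sim> a) \<in> carrier L"
  by (simp add: bneg_eq bimp_closed)

lemma bneg_le_iff:
  assumes "a \<in> carrier L" "x \<in> carrier L"
  shows "(\<sim> a) \<sqsubseteq> x \<longleftrightarrow> (\<forall>z\<in>carrier L. x \<sqsubseteq> z \<longrightarrow> a \<sqsubseteq> z \<longrightarrow> z = \<top>)"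
  using assms by (simp add: bneg_eq bimp_le_iff top_le_iff)

lemma le_bneg_self:
  assumes "a \<in> carrier L" "x \<in> carrier L" "a \<sqsubseteq> x" "(\<sim> a) \<sqsubseteq> x"
  shows "x = \<top>"
  using assms bneg_le_iff by blast

lemma bneg_eq_bottom_iff: "a \<in> carrier L \<Longrightarrow> (\<sim> a) = \<bottom> \<longleftrightarrow> a = \<top>"
  by (simp add: bneg_eq bimp_eq_bottom_iff top_le_iff)

lemma meet_eq_bottom:
  assumes "x \<in> carrier L" "y \<in> carrier L" "x = \<bottom> \<or> y = \<bottom>"
  shows "x \<sqinter> y = \<bottom>"
  using assms le_bottom_iff[of "x \<sqinter> y"] meet_left[of x y] meet_right[of x y] by auto

text \<open>A meet has no such pointwise clause, so the residuation is turned around: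
  \<open>z \<leadsto> c\<close> lies below \<open>a\<close> and below \<open>b\<close>, hence below
  their meet and below \<open>z\<close>, which forces \<open>c \<sqsubseteq> z\<close>.\<close>

lemma disjE_valid:
  assumes [simp]: "a \<in> carrier L" "b \<in> carrier L" "c \<in> carrier L" "z \<in> carrier L"
    and "(a \<leadsto> c) \<sqsubseteq> z" "(b \<leadsto> c) \<sqsubseteq> z" "a \<sqinter> b \<sqsubseteq> z"
  shows "c \<sqsubseteq> z"
proof -
  have "c \<sqsubseteq> a \<squnion> z" "c \<sqsubseteq> b \<squnion> z"
    using assms by (simp_all add: bimp_iff)
  then have "(z \<leadsto> c) \<sqsubseteq> a" "(z \<leadsto> c) \<sqsubseteq> b"
    using join_comm[of L a z] join_comm[of L b z] bimp_iff[of z c a] bimp_iff[of z c b] by simp_all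
  then have "(z \<leadsto> c) \<sqsubseteq> a \<sqinter> b"
    by (simp add: bimp_closed meet_le)
  then have "(z \<leadsto> c) \<sqsubseteq> z"
    using le_trans[OF _ assms(7)] by (simp add: bimp_closed)
  then show ?thesis by (simp add: bimp_le_iff)
qed

lemma eval_closed:
  assumes "\<And>i. v i \<in> carrier L"
  shows "eval L v A \<in> carrier L"
  by (induction A) (simp_all add: assms bneg_closed bimp_closed)

theorem ipc_soundness:
  assumes "\<Gamma> \<turnstile>\<^sub>I A" and v: "\<And>i. v i \<in> carrier L"
    and "\<And>B. B \<in> \<Gamma> \<Longrightarrow> eval L v B = \<bottom>"
  shows "eval L v A = \<bottom>"
  using assms(1)
proof induction
  case (premise A)
  then show ?case by (rule assms(3))
next
  case (mp A B)
  then show ?case by (simp add: bimp_eq_bottom_iff le_bottom_iff eval_closed v)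
next
  case (imp_K A B)
  then show ?case by (simp add: eval_closed[OF v] bimp_closed bimp_eq_bottom_iff bimp_le_iff)
next
  case (imp_S A B C)
  then show ?case
    by (simp add: eval_closed[OF v] bimp_closed bimp_eq_bottom_iff bimp_le_iff)
next
  case (conjI A B)
  then show ?case by (simp add: eval_closed[OF v] bimp_closed bimp_eq_bottom_iff bimp_le_iff join_le_iff)
next
  case (conjE1 A B)
  then show ?case by (simp add: eval_closed[OF v] bimp_eq_bottom_iff join_left)
next
  case (conjE2 A B)
  then show ?case by (simp add: eval_closed[OF v] bimp_eq_bottom_iff join_right)
next
  case (disjI1 A B)
  then show ?case by (simp add: eval_closed[OF v] bimp_eq_bottom_iff meet_left)
next
  case (disjI2 B A)
  then show ?case by (simp add: eval_closed[OF v] bimp_eq_bottom_iff meet_right)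
next
  case (disjE A C B)
  let ?a = "eval L v A" and ?b = "eval L v B" and ?c = "eval L v C"
  \<comment> \<open>\<open>y\<close> and \<open>z\<close> are the successive elements that arise
    from unfolding the two inner implications.\<close>
  have "?c \<sqsubseteq> z" if "y \<in> carrier L" "z \<in> carrier L" "(?a \<leadsto> ?c) \<sqsubseteq> y" "(?b \<leadsto> ?c) \<sqsubseteq> y" "y \<sqsubseteq> z"
    "?a \<sqinter> ?b \<sqsubseteq> z" for y z
  proof (rule disjE_valid[of ?a ?b])
    show "(?a \<leadsto> ?c) \<sqsubseteq> z" "(?b \<leadsto> ?c) \<sqsubseteq> z"
      using le_trans[OF that(3,5)] le_trans[OF that(4,5)] that(1,2)
      by (simp_all add: eval_closed[OF v] bimp_closed)
  qed (use that in \<open>auto intro: eval_closed[OF v]\<close>)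
  then have "((?b \<leadsto> ?c) \<leadsto> (?a \<sqinter> ?b \<leadsto> ?c)) \<sqsubseteq> (?a \<leadsto> ?c)"
    using bimp_le_iff[of "?b \<leadsto> ?c" "?a \<sqinter> ?b \<leadsto> ?c" "?a \<leadsto> ?c"] bimp_le_iff[of "?a \<sqinter> ?b" ?c]
    by (simp add: eval_closed[OF v] bimp_closed)
  then show ?case by (simp add: bimp_eq_bottom_iff eval_closed[OF v] bimp_closed)
next
  case (negI A B)
  then show ?case
    by (simp add: eval_closed[OF v] bimp_closed bneg_closed bimp_eq_bottom_iff bimp_le_iff bneg_le_iff)
next
  case (negE A B)
  let ?a = "eval L v A" and ?b = "eval L v B"
  have "?b \<sqsubseteq> z" if "z \<in> carrier L" "(\<sim> ?a) \<sqsubseteq> z" "?a \<sqsubseteq> z" for z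
    using le_bneg_self[OF eval_closed[OF v] that(1,3,2)] top_higher[OF eval_closed[OF v]] by simp
  then have "(?a \<leadsto> ?b) \<sqsubseteq> (\<sim> ?a)"
    by (simp add: eval_closed[OF v] bneg_closed bimp_le_iff)
  then show ?case by (simp add: eval_closed[OF v] bimp_closed bneg_closed bimp_eq_bottom_iff)
qed

section \<open>Coatoms and the validity of \<open>phi k\<close>\<close>

lemma exists_coatom_above:
  assumes "finite (carrier L)" "x \<in> carrier L" "x \<noteq> \<top>"
  shows "\<exists>c\<in>coatoms L. x \<sqsubseteq> c"
proof -
  let ?up = "\<lambda>y. {z \<in> carrier L. y \<sqsubseteq> z}"
  \<comment> \<open>Among the proper elements above \<open>x\<close>, one with the fewest elements
    above it is maximal, as a strict step up loses at least that element itself.\<close>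
  have "\<exists>c. (c \<in> carrier L - {\<top>} \<and> x \<sqsubseteq> c) \<and>
      (\<forall>y. (y \<in> carrier L - {\<top>} \<and> x \<sqsubseteq> y) \<longrightarrow> card (?up c) \<le> card (?up y))"
    by (rule ex_has_least_nat[of _ x]) (use assms in auto)
  then obtain c where c: "c \<in> carrier L" "c \<noteq> \<top>" "x \<sqsubseteq> c"
    and min: "\<And>y. y \<in> carrier L \<Longrightarrow> y \<noteq> \<top> \<Longrightarrow> x \<sqsubseteq> y \<Longrightarrow> card (?up c) \<le> card (?up y)"
    by blast
  have "y = c" if y: "y \<in> carrier L" "y \<noteq> \<top>" "c \<sqsubseteq> y" for y
  proof (rule ccontr)
    assume "y \<noteq> c"
    then have "?up y \<subset> ?up c" using c y by (auto intro: le_trans dest: le_antisym)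
    then have "card (?up y) < card (?up c)" using assms(1) by (intro psubset_card_mono) auto
    then show False using min[of y] y c le_trans assms(2) by (meson leD)
  qed
  then show ?thesis using c unfolding coatoms_def by blast
qed

lemma coatomD:
  assumes "c \<in> coatoms L"
  shows "c \<in> carrier L" "c \<noteq> \<top>"
  using assms unfolding coatoms_def by auto

lemma eval_foldr_Disj:
  assumes "\<And>i. v i \<in> carrier L" "(\<exists>B\<in>set Bs. eval L v B = \<bottom>) \<or> eval L v C = \<bottom>"
  shows "eval L v (foldr Disj Bs C) = \<bottom>"
  using assms(2) by (induction Bs) (auto intro!: meet_eq_bottom eval_closed[OF assms(1)])

lemma eval_foldl_Conj_le_iff:
  assumes "\<And>i. v i \<in> carrier L" "x \<in> carrier L"
  shows "eval L v (foldl Conj C Bs) \<sqsubseteq> x \<longleftrightarrow> eval L v C \<sqsubseteq> x \<and> (\<forall>B\<in>set Bs. eval L v B \<sqsubseteq> x)"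
  by (induction Bs arbitrary: C) (auto simp: join_le_iff eval_closed assms)

text \<open>No coatom lies above both \<open>v 1\<close> and its negation, so with at most one
  coatom one of the two is already \<open>\<top>\<close>, and its negation is
  \<open>\<bottom>\<close>.\<close>

lemma eval_phi_1:
  assumes "finite (carrier L)" "card (coatoms L) \<le> 1" and v: "\<And>i. v i \<in> carrier L"
  shows "eval L v (phi 1) = \<bottom>"
proof -
  let ?a = "v 1"
  have [simp]: "?a \<in> carrier L" "(\<sim> ?a) \<in> carrier L" "(\<sim> (\<sim> ?a)) \<in> carrier L"
    by (simp_all add: v bneg_closed)
  have fin: "finite (coatoms L)"
    using assms(1) by (rule rev_finite_subset) (auto simp: coatomD)
  have "?a = \<top> \<or> (\<sim> ?a) = \<top>"
  proof (rule ccontr)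
    assume "\<not> ?thesis"
    then obtain c d where "c \<in> coatoms L" "?a \<sqsubseteq> c" "d \<in> coatoms L" "(\<sim> ?a) \<sqsubseteq> d"
      using exists_coatom_above[OF assms(1) v] exists_coatom_above[OF assms(1) bneg_closed[OF v]] by blast
    moreover from this have "c = d" using assms(2) fin by (metis One_nat_def card_le_Suc0_iff_eq)
    ultimately show False using le_bneg_self[OF v] coatomD by blast
  qed
  then have "(\<sim> ?a) = \<bottom> \<or> (\<sim> (\<sim> ?a)) = \<bottom>" using bneg_eq_bottom_iff v bneg_closed by blast
  then have "(\<sim> ?a) \<sqinter> (\<sim> (\<sim> ?a)) = \<bottom>" by (intro meet_eq_bottom bneg_closed v)
  then show ?thesis by (simp add: phi_def)
qed

text \<open>The refuting antichain lives on one coatom fewer than the algebra has, hence a bound on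
  \<open>m choose (m div 2)\<close> strictly below their number.\<close>

lemma eval_phi_gt_1:
  assumes "k > 1" and fin: "finite (carrier L)"
    and few: "\<And>m. m < card (coatoms L) \<Longrightarrow> m choose (m div 2) < k"
    and v: "\<And>i. v i \<in> carrier L"
  shows "eval L v (phi k) = \<bottom>"
proof (rule ccontr)
  assume nz: "eval L v (phi k) \<noteq> \<bottom>"
  define U where "U i = {c \<in> coatoms L. (\<sim> (v i)) \<sqsubseteq> c}" for i
  let ?conj = "foldl Conj (Neg (Var 1)) [Neg (Var i). i \<leftarrow> [2..<Suc k]]"
  have fin': "finite (coatoms L)"
    using fin by (rule rev_finite_subset) (auto simp: coatomD)
  note [simp] = v bneg_closed
  have "eval L v (Neg ?conj) \<noteq> \<bottom>"
    using nz assms(1) eval_foldr_Disj[OF v] by (auto simp: phi_def)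
  then have "eval L v ?conj \<noteq> \<top>"
    using eval_closed[where A = ?conj, OF v] by (simp add: bneg_eq_bottom_iff)
  \<comment> \<open>A coatom above the value of the whole conjunction lies above every
    \<open>\<sim> (v i)\<close> with \<open>i\<close> in \<open>{1..k}\<close>, so it is common to
    these sets \<open>U i\<close>.\<close>
  then obtain c where c: "c \<in> coatoms L" "eval L v ?conj \<sqsubseteq> c"
    using exists_coatom_above[OF fin eval_closed[where v = v, OF v]] by blast
  have cU: "c \<in> U i" if "i \<in> {1..k}" for i
  proof -
    have "i = 1 \<or> i \<in> {2..k}" using that by auto
    then show ?thesis
      using c coatomD[OF c(1)] by (auto simp: eval_foldl_Conj_le_iff[OF v] U_def)
  qed
  have sep: "\<not> U i \<subseteq> U j" if "i \<in> {1..k}" "j \<in> {1..k}" "i \<noteq> j" for i j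
  proof -
    have "eval L v (Imp (Neg (Var i)) (Neg (Var j))) \<noteq> \<bottom>"
    proof
      assume "eval L v (Imp (Neg (Var i)) (Neg (Var j))) = \<bottom>"
      moreover have "Imp (Neg (Var i)) (Neg (Var j)) \<in>
          set [Imp (Neg (Var i)) (Neg (Var j)). i \<leftarrow> [1..<Suc k], j \<leftarrow> [1..<Suc k], i \<noteq> j]"
        using that by (auto simp: image_iff)
      ultimately have "eval L v (phi k) = \<bottom>"
        unfolding phi_def using assms(1)
        by (subst if_not_P, simp) (rule eval_foldr_Disj[OF v], blast)
      with nz show False ..
    qed
    then have "\<not> (\<sim> (v j)) \<sqsubseteq> (\<sim> (v i))" by (simp add: bimp_eq_bottom_iff)
    \<comment> \<open>A proper element above \<open>\<sim> (v i)\<close> and \<open>v j\<close>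
      witnesses the failure; a coatom \<open>d\<close> above it lies in \<open>U i\<close> but,
      being above \<open>v j\<close>, not in \<open>U j\<close>.\<close>
    then obtain z where z: "z \<in> carrier L" "(\<sim> (v i)) \<sqsubseteq> z" "v j \<sqsubseteq> z" "z \<noteq> \<top>"
      by (auto simp: bneg_le_iff[of "v j"])
    obtain d where d: "d \<in> coatoms L" "z \<sqsubseteq> d" using exists_coatom_above[OF fin z(1,4)] by blast
    note coatomD[OF d(1)]
    moreover have "(\<sim> (v i)) \<sqsubseteq> d" "v j \<sqsubseteq> d"
      using z d coatomD[OF d(1)] by (auto intro: le_trans)
    moreover from calculation have "\<not> (\<sim> (v j)) \<sqsubseteq> d" using le_bneg_self[OF v] by blast
    ultimately show ?thesis using d(1) unfolding U_def by blast
  qed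
  \<comment> \<open>Dropping the shared \<open>c\<close> keeps the sets incomparable and leaves one
    coatom fewer for Sperner's bound.\<close>
  define V where "V i = U i - {c}" for i
  have V: "i = j" if "i \<in> {1..k}" "j \<in> {1..k}" "V i \<subseteq> V j" for i j
    using sep[OF that(1,2)] cU[OF that(2)] that(3) unfolding V_def by blast
  then have "inj_on V {1..k}" by (auto intro!: inj_onI simp del: atLeastAtMost_iff)
  then have "card (V ` {1..k}) = k" by (simp add: card_image)
  moreover have "antichain (V ` {1..k})" unfolding antichain_def using V by blast
  moreover have "V ` {1..k} \<subseteq> Pow (coatoms L - {c})" unfolding V_def U_def by blast
  ultimately have "k \<le> card (coatoms L - {c}) choose (card (coatoms L - {c}) div 2)"
    using Sperner[of "coatoms L - {c}" "V ` {1..k}"] fin' by simp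
  moreover have "card (coatoms L - {c}) < card (coatoms L)"
    using c fin' by (meson card_Diff1_less)
  ultimately show False using few leD by blast
qed

lemma eval_subst: "eval L v (subst s A) = eval L (\<lambda>i. eval L v (s i)) A"
  by (induction A) simp_all

end

section \<open>Prime theories\<close>

lemma derives_mono: "\<Gamma> \<turnstile>\<^sub>I A \<Longrightarrow> \<Gamma> \<subseteq> \<Delta> \<Longrightarrow> \<Delta> \<turnstile>\<^sub>I A"
  by (induction rule: ipc_derives.induct) (auto intro: ipc_derives.intros)

lemma derives_imp_refl: "\<Gamma> \<turnstile>\<^sub>I Imp A A"
  by (rule mp[OF mp[OF imp_S[of _ _ "Imp A A"] imp_K] imp_K])

lemma derives_imp_weaken: "\<Gamma> \<turnstile>\<^sub>I B \<Longrightarrow> \<Gamma> \<turnstile>\<^sub>I Imp A B"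
  by (rule mp[OF imp_K])

lemma deduction_theorem: "insert A \<Gamma> \<turnstile>\<^sub>I B \<Longrightarrow> \<Gamma> \<turnstile>\<^sub>I Imp A B"
proof (induction rule: ipc_derives.induct)
  case (premise B)
  then show ?case
    using derives_imp_refl derives_imp_weaken[OF ipc_derives.premise, of B \<Gamma>] by blast
next
  case (mp B C)
  show ?case by (rule ipc_derives.mp[OF ipc_derives.mp[OF imp_S mp.IH(1)] mp.IH(2)])
qed (rule derives_imp_weaken, rule ipc_derives.intros(3-))+

text \<open>A derivation uses finitely many premises, so one member of the chain contains them all;
  this is what Zorn's lemma requires. \<open>C \<noteq> {}\<close> provides a member for the
  axioms.\<close>

lemma derives_chain_Union:
  assumes "\<Union>C \<turnstile>\<^sub>I A" "C \<noteq> {}" "\<And>X Y. X \<in> C \<Longrightarrow> Y \<in> C \<Longrightarrow> X \<subseteq> Y \<or> Y \<subseteq> X"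
  shows "\<exists>X\<in>C. X \<turnstile>\<^sub>I A"
  using assms(1)
proof induction
  case (premise A)
  then show ?case by (auto intro: ipc_derives.premise)
next
  case (mp A B)
  then obtain X Y where XY: "X \<in> C" "Y \<in> C" "X \<turnstile>\<^sub>I Imp A B" "Y \<turnstile>\<^sub>I A" by blast
  with assms(3) have "X \<union> Y \<in> C" by (metis sup.absorb1 sup.absorb2)
  moreover have "X \<union> Y \<turnstile>\<^sub>I B"
    by (rule ipc_derives.mp[OF derives_mono[OF XY(3)] derives_mono[OF XY(4)]]) auto
  ultimately show ?case ..
qed (use assms(2) in \<open>auto intro: ipc_derives.intros(3-)\<close>)

section \<open>Lindenbaum extensions to prime and complete theories\<close>

text \<open>The points of the canonical Kripke model. The language has no constant for falsity, so
  consistency is expressed by \<open>\<Delta> \<noteq> UNIV\<close>.\<close>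

definition prime_theory :: "form set \<Rightarrow> bool" where
  "prime_theory \<Delta> \<longleftrightarrow> (\<forall>B. \<Delta> \<turnstile>\<^sub>I B \<longrightarrow> B \<in> \<Delta>) \<and> \<Delta> \<noteq> UNIV \<and>
    (\<forall>B C. Disj B C \<in> \<Delta> \<longrightarrow> B \<in> \<Delta> \<or> C \<in> \<Delta>)"

text \<open>Classical maximal consistent theories; they are the maximal points among the prime
  theories.\<close>

definition complete_theory :: "form set \<Rightarrow> bool" where
  "complete_theory \<Delta> \<longleftrightarrow> prime_theory \<Delta> \<and> (\<forall>B. B \<in> \<Delta> \<or> Neg B \<in> \<Delta>)"

text \<open>Zorn's lemma gives a set maximal among those not deriving \<open>A\<close>. Every
  formula outside it implies \<open>A\<close>, and disjunction elimination then yields primeness.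
  The implication is exported because it produces complete theories when \<open>A\<close> is a
  contradiction.\<close>

lemma exists_prime_theory_maximal:
  assumes "\<not> \<Gamma> \<turnstile>\<^sub>I A"
  obtains \<Delta> where "prime_theory \<Delta>" "\<Gamma> \<subseteq> \<Delta>" "A \<notin> \<Delta>" "\<forall>B. B \<notin> \<Delta> \<longrightarrow> Imp B A \<in> \<Delta>"
proof -
  let ?\<A> = "{\<Delta>. \<Gamma> \<subseteq> \<Delta> \<and> \<not> \<Delta> \<turnstile>\<^sub>I A}"
  have "\<exists>M\<in>?\<A>. \<forall>X\<in>?\<A>. M \<subseteq> X \<longrightarrow> X = M"
  proof (rule subset_Zorn_nonempty)
    show "?\<A> \<noteq> {}" using assms by blast
    fix C assume C: "C \<noteq> {}" "subset.chain ?\<A> C"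
    then have sub: "C \<subseteq> ?\<A>" and tot: "\<And>X Y. X \<in> C \<Longrightarrow> Y \<in> C \<Longrightarrow> X \<subseteq> Y \<or> Y \<subseteq> X"
      by (auto simp: subset_chain_def)
    have "\<not> \<Union>C \<turnstile>\<^sub>I A"
      using derives_chain_Union[OF _ C(1) tot] sub by blast
    then show "\<Union>C \<in> ?\<A>" using C(1) sub by blast
  qed
  then obtain \<Delta> where "\<Delta> \<in> ?\<A>" and max: "\<forall>X\<in>?\<A>. \<Delta> \<subseteq> X \<longrightarrow> X = \<Delta>" ..
  then have \<Delta>: "\<Gamma> \<subseteq> \<Delta>" "\<not> \<Delta> \<turnstile>\<^sub>I A" by auto
  have imp: "\<Delta> \<turnstile>\<^sub>I Imp B A" if "B \<notin> \<Delta>" for B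
  proof -
    have "insert B \<Delta> \<turnstile>\<^sub>I A" using bspec[OF max, of "insert B \<Delta>"] \<Delta>(1) that by auto
    then show ?thesis by (rule deduction_theorem)
  qed
  have closed: "B \<in> \<Delta>" if "\<Delta> \<turnstile>\<^sub>I B" for B
    using mp[OF imp that] \<Delta>(2) by blast
  have "B \<in> \<Delta> \<or> C \<in> \<Delta>" if "Disj B C \<in> \<Delta>" for B C
    using mp[OF mp[OF mp[OF disjE imp[of B]] imp[of C]] premise[OF that]] \<Delta>(2) by blast
  moreover have "A \<notin> \<Delta>" using \<Delta>(2) premise by blast
  ultimately have "prime_theory \<Delta>" using closed unfolding prime_theory_def by blast
  then show ?thesis using \<Delta>(1) \<open>A \<notin> \<Delta>\<close>
  proof (rule that)
    show "\<forall>B. B \<notin> \<Delta> \<longrightarrow> Imp B A \<in> \<Delta>" using closed[OF imp] by simp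
  qed
qed

text \<open>\<open>Neg (Imp A A)\<close> plays the part of falsity: in a prime theory maximal
  without it, every formula outside implies it and is therefore negated.\<close>

lemma exists_complete_theory:
  assumes "\<not> \<Gamma> \<turnstile>\<^sub>I Neg (Imp A A)"
  obtains \<Delta> where "complete_theory \<Delta>" "\<Gamma> \<subseteq> \<Delta>"
proof -
  obtain \<Delta> where \<Delta>: "prime_theory \<Delta>" "\<Gamma> \<subseteq> \<Delta>" "Neg (Imp A A) \<notin> \<Delta>"
      "\<forall>B. B \<notin> \<Delta> \<longrightarrow> Imp B (Neg (Imp A A)) \<in> \<Delta>"
    using assms by (rule exists_prime_theory_maximal)
  have "Neg B \<in> \<Delta>" if "B \<notin> \<Delta>" for B
  proof -
    have "\<Delta> \<turnstile>\<^sub>I Neg B"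
      by (rule mp[OF mp[OF negI derives_imp_weaken[OF derives_imp_refl]] premise[OF \<Delta>(4)[rule_format, OF that]]])
    then show ?thesis using \<Delta>(1) unfolding prime_theory_def by blast
  qed
  then have "complete_theory \<Delta>" using \<Delta>(1) unfolding complete_theory_def by blast
  then show ?thesis using \<Delta>(2) by (rule that)
qed

context
  fixes \<Delta>
  assumes prime: "prime_theory \<Delta>"
begin

lemma prime_theory_closed: "\<Delta> \<turnstile>\<^sub>I B \<Longrightarrow> B \<in> \<Delta>"
  using prime unfolding prime_theory_def by blast

lemma prime_theory_mp: "Imp B C \<in> \<Delta> \<Longrightarrow> B \<in> \<Delta> \<Longrightarrow> C \<in> \<Delta>"
  by (rule prime_theory_closed, rule mp) (auto intro: premise)

lemma prime_theory_derives: "\<Delta> \<turnstile>\<^sub>I Imp B C \<Longrightarrow> B \<in> \<Delta> \<Longrightarrow> C \<in> \<Delta>"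
  by (rule prime_theory_mp[OF prime_theory_closed])

lemma prime_theory_Conj: "Conj B C \<in> \<Delta> \<longleftrightarrow> B \<in> \<Delta> \<and> C \<in> \<Delta>"
  using prime_theory_derives[OF conjE1] prime_theory_derives[OF conjE2]
    prime_theory_mp[OF prime_theory_derives[OF ipc_derives.conjI]] by blast

lemma prime_theory_Disj: "Disj B C \<in> \<Delta> \<longleftrightarrow> B \<in> \<Delta> \<or> C \<in> \<Delta>"
  using prime_theory_derives[OF ipc_derives.disjI1] prime_theory_derives[OF ipc_derives.disjI2]
    prime unfolding prime_theory_def by blast

lemma prime_theory_consistent: "B \<in> \<Delta> \<Longrightarrow> Neg B \<notin> \<Delta>"
  using prime_theory_mp[OF prime_theory_derives[OF negE]] prime unfolding prime_theory_def by blast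

lemma prime_theory_not_Imp:
  assumes "Imp B C \<notin> \<Delta>"
  obtains \<Delta>' where "prime_theory \<Delta>'" "\<Delta> \<subseteq> \<Delta>'" "B \<in> \<Delta>'" "C \<notin> \<Delta>'"
proof -
  have "\<not> insert B \<Delta> \<turnstile>\<^sub>I C" 
    using assms prime_theory_closed[OF deduction_theorem] by blast
  then obtain \<Delta>' where "prime_theory \<Delta>'" "insert B \<Delta> \<subseteq> \<Delta>'" "C \<notin> \<Delta>'"
    by (rule exists_prime_theory_maximal)
  then show ?thesis using that[of \<Delta>'] by simp
qed

text \<open>Were \<open>B\<close> inconsistent with \<open>\<Delta>\<close>, negation introduction
  would put \<open>Neg B\<close> into \<open>\<Delta>\<close>. Making the extension complete lets
  the same fact produce a maximal point above any prime theory.\<close>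

lemma prime_theory_not_Neg:
  assumes "Neg B \<notin> \<Delta>"
  obtains \<Delta>' where "complete_theory \<Delta>'" "\<Delta> \<subseteq> \<Delta>'" "B \<in> \<Delta>'"
proof -
  have "\<not> insert B \<Delta> \<turnstile>\<^sub>I Neg (Imp B B)"
  proof
    assume "insert B \<Delta> \<turnstile>\<^sub>I Neg (Imp B B)"
    then have "\<Delta> \<turnstile>\<^sub>I Neg B"
      by (rule mp[OF mp[OF negI derives_imp_weaken[OF derives_imp_refl]] deduction_theorem])
    then have "Neg B \<in> \<Delta>" by (rule prime_theory_closed)
    with assms show False ..
  qed
  then obtain \<Delta>' where "complete_theory \<Delta>'" "insert B \<Delta> \<subseteq> \<Delta>'"
    by (rule exists_complete_theory)
  then show ?thesis using that[of \<Delta>'] by simp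
qed

lemma prime_theory_extends_to_complete:
  obtains M where "complete_theory M" "\<Delta> \<subseteq> M"
proof -
  have "Neg (Imp (Var 0) (Var 0)) \<notin> \<Delta>"
    using prime_theory_consistent prime_theory_closed[OF derives_imp_refl] by blast
  then obtain M where "complete_theory M" "\<Delta> \<subseteq> M" by (rule prime_theory_not_Neg)
  then show ?thesis by (rule that)
qed

lemma prime_theory_foldr_Disj: "foldr Disj Bs C \<in> \<Delta> \<longleftrightarrow> (\<exists>B\<in>set Bs. B \<in> \<Delta>) \<or> C \<in> \<Delta>"
  by (induction Bs) (auto simp: prime_theory_Disj)

lemma prime_theory_foldl_Conj: "foldl Conj C Bs \<in> \<Delta> \<longleftrightarrow> C \<in> \<Delta> \<and> set Bs \<subseteq> \<Delta>"
  by (induction Bs arbitrary: C) (auto simp: prime_theory_Conj)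

end

section \<open>Separating finitely many complete theories by formulas\<close>

lemma complete_theory_prime: "complete_theory \<Delta> \<Longrightarrow> prime_theory \<Delta>"
  unfolding complete_theory_def by simp

lemma complete_theory_Neg: "complete_theory \<Delta> \<Longrightarrow> Neg B \<in> \<Delta> \<longleftrightarrow> B \<notin> \<Delta>"
  using prime_theory_consistent[of \<Delta> B] unfolding complete_theory_def by blast

lemma complete_theory_maximal:
  assumes "complete_theory M" "complete_theory N" "M \<subseteq> N"
  shows "M = N"
proof
  show "N \<subseteq> M"
    using assms(3) complete_theory_Neg[OF assms(1)] complete_theory_Neg[OF assms(2)] by blast
qed (fact assms)

text \<open>Distinct complete theories are incomparable, so \<open>N\<close> has a formula missing
  from each given \<open>M\<close>; the conjunction of these is missing from all.\<close>

lemma complete_theories_separated: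
  assumes "finite \<M>" "\<And>M. M \<in> \<M> \<Longrightarrow> complete_theory M" "complete_theory N" "N \<notin> \<M>"
  shows "\<exists>B\<in>N. \<forall>M\<in>\<M>. B \<notin> M"
  using assms
proof (induction \<M> rule: finite_induct)
  case empty
  have "Imp (Var 0) (Var 0) \<in> N"
    using empty.prems(2) by (rule prime_theory_closed[OF complete_theory_prime derives_imp_refl])
  then show ?case by blast
next
  case (insert M \<M>)
  then obtain B where B: "B \<in> N" "\<forall>M\<in>\<M>. B \<notin> M" by auto
  obtain C where "C \<in> N" "C \<notin> M"
    using complete_theory_maximal[of N M] insert.prems by blast
  then have "Conj B C \<in> N" "\<forall>M\<in>insert M \<M>. Conj B C \<notin> M"
    using B insert.prems prime_theory_Conj[OF complete_theory_prime] by auto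
  then show ?case by blast
qed

text \<open>A finite set of complete theories is discrete: the disjunction of formulas isolating the
  members of \<open>\<F>\<close> defines \<open>\<F>\<close>, starting from a contradiction for the
  empty set.\<close>

lemma complete_theories_definable_subset:
  assumes "finite \<M>" "\<And>M. M \<in> \<M> \<Longrightarrow> complete_theory M" "\<F> \<subseteq> \<M>"
  shows "\<exists>B. \<forall>M\<in>\<M>. B \<in> M \<longleftrightarrow> M \<in> \<F>"
proof -
  have "finite \<F>" using assms(1,3) by (rule rev_finite_subset)
  then show ?thesis using assms(3)
  proof (induction \<F> rule: finite_induct)
    case empty
    have "Neg (Imp (Var 0) (Var 0)) \<notin> M" if "M \<in> \<M>" for M
      using assms(2)[OF that] complete_theory_Neg
        prime_theory_closed[OF complete_theory_prime derives_imp_refl] by blast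
    then show ?case by blast
  next
    case (insert N \<F>)
    then obtain B where B: "\<forall>M\<in>\<M>. B \<in> M \<longleftrightarrow> M \<in> \<F>" by auto
    obtain C where "C \<in> N" "\<forall>M\<in>\<M> - {N}. C \<notin> M"
      using complete_theories_separated[of "\<M> - {N}" N] assms(1,2) insert.prems by auto
    then have "\<forall>M\<in>\<M>. Disj B C \<in> M \<longleftrightarrow> M \<in> insert N \<F>"
      using B assms(2) prime_theory_Disj[OF complete_theory_prime] by auto
    then show ?case by blast
  qed
qed

lemma subst_foldr_Disj: "subst s (foldr Disj Bs C) = foldr Disj (map (subst s) Bs) (subst s C)"
  by (induction Bs) simp_all

lemma subst_foldl_Conj: "subst s (foldl Conj C Bs) = foldl Conj (subst s C) (map (subst s) Bs)"
  by (induction Bs arbitrary: C) simp_all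

lemma prime_theory_phi_gt_1:
  assumes "k > 1" "prime_theory \<Delta>" "subst s (phi k) \<in> \<Delta>"
  shows "(\<exists>i\<in>{1..k}. \<exists>j\<in>{1..k}. i \<noteq> j \<and> Imp (Neg (s i)) (Neg (s j)) \<in> \<Delta>) \<or>
    Neg (foldl Conj (Neg (s 1)) [Neg (s i). i \<leftarrow> [2..<Suc k]]) \<in> \<Delta>"
proof -
  let ?Bs = "[Imp (Neg (Var i)) (Neg (Var j)). i \<leftarrow> [1..<Suc k], j \<leftarrow> [1..<Suc k], i \<noteq> j]"
  let ?C = "foldl Conj (Neg (Var 1)) [Neg (Var i). i \<leftarrow> [2..<Suc k]]"
  have "subst s (phi k) = foldr Disj (map (subst s) ?Bs) (subst s (Neg ?C))"
    unfolding phi_def subst_foldr_Disj[symmetric] using assms(1) by simp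
  with assms(3) consider B where "B \<in> set ?Bs" "subst s B \<in> \<Delta>" | "subst s (Neg ?C) \<in> \<Delta>"
    using prime_theory_foldr_Disj[OF assms(2), of "map (subst s) ?Bs" "subst s (Neg ?C)"]
    by (auto simp del: upt_Suc set_concat subst.simps)
  then show ?thesis
  proof cases
    case 1
    then obtain i j where "i \<in> {1..k}" "j \<in> {1..k}" "i \<noteq> j" "B = Imp (Neg (Var i)) (Neg (Var j))"
      by (auto split: if_splits)
    moreover from this have "Imp (Neg (s i)) (Neg (s j)) \<in> \<Delta>" using 1(2) by simp
    ultimately show ?thesis by blast
  next
    case 2
    then show ?thesis by (simp add: subst_foldl_Conj comp_def del: upt_Suc)
  qed
qed

text \<open>Among more than \<open>n\<close> complete theories pick one, \<open>N\<close>, and \<open>k\<close> subsets of size \<open>n div 2\<close> of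
  the others; the formulas defining these subsets, with \<open>N\<close> added to each, refute \<open>phi k\<close>.\<close>

lemma complete_theories_above_bound:
  assumes "k \<ge> 1" "n \<ge> 1" "k \<le> n choose (n div 2)"
    and prime: "prime_theory \<Delta>" and phi: "\<And>s. subst s (phi k) \<in> \<Delta>"
  shows "finite {M. complete_theory M \<and> \<Delta> \<subseteq> M} \<and> card {M. complete_theory M \<and> \<Delta> \<subseteq> M} \<le> n"
\<comment> \<open>Bounding all finite subsets gives finiteness and the bound together; definability
  is available for finite families only.\<close>
proof (rule finite_if_finite_subsets_card_bdd, rule ccontr)
  fix \<M> assume \<M>: "\<M> \<subseteq> {M. complete_theory M \<and> \<Delta> \<subseteq> M}" "finite \<M>" "\<not> card \<M> \<le> n"
  have complete: "complete_theory M" if "M \<in> \<M>" for M using \<M>(1) that by blast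
  have above: "\<Delta> \<subseteq> M" if "M \<in> \<M>" for M using \<M>(1) that by blast
  have "\<M> \<noteq> {}" using \<M>(3) by auto
  then obtain N where N: "N \<in> \<M>" by blast
  have "n \<le> card (\<M> - {N})" using \<M>(2,3) N by simp
  then obtain \<G> where \<G>: "\<G> \<subseteq> \<M> - {N}" "card \<G> = n" "finite \<G>"
    using obtain_subset_with_card_n[of n "\<M> - {N}"] by blast
  show False
  proof (cases "k = 1")
    case True
    \<comment> \<open>\<open>p\<close> isolates \<open>N\<close>, so \<open>Neg p\<close> fails at
      \<open>N\<close> and \<open>Neg (Neg p)\<close> fails at any other theory
      \<open>M\<close>.\<close>
    obtain p where p: "\<forall>M\<in>\<M>. p \<in> M \<longleftrightarrow> M \<in> {N}"
      using complete_theories_definable_subset[OF \<M>(2) complete, of "{N}"] N by blast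
    obtain M where M: "M \<in> \<M>" "M \<noteq> N" using \<G> assms(2) by (cases "\<G> = {}") auto
    have "Disj (Neg p) (Neg (Neg p)) \<in> \<Delta>"
      using phi[of "\<lambda>_. p"] True by (simp add: phi_def)
    then have "Neg p \<in> N \<or> Neg (Neg p) \<in> M"
      using prime_theory_Disj[OF prime] above[OF N] above[OF M(1)] by blast
    then show False
      using p N M complete_theory_Neg[OF complete[OF N]] complete_theory_Neg[OF complete[OF M(1)]]
      by auto
  next
    case False
    then have k: "k > 1" using assms(1) by simp
    let ?F = "{S. S \<subseteq> \<G> \<and> card S = n div 2}"
    have "card {1..k} \<le> card ?F" using n_subsets[OF \<G>(3)] \<G>(2) assms(3) by simp
    moreover have "finite ?F" using \<G>(3) by simp
    ultimately obtain S where S: "S ` {1..k} \<subseteq> ?F" "inj_on S {1..k}"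
      using card_le_inj[of "{1..k}" ?F] by blast
    \<comment> \<open>The formulas define complements, so that \<open>Neg (p i)\<close> holds on
      \<open>S i \<inter> \<G>\<close>, at \<open>N\<close>, and at all of \<open>\<M>\<close>
      outside \<open>\<G>\<close>. Every index is covered since a substitution is total.\<close>
    have "\<forall>i. \<exists>p. \<forall>M\<in>\<M>. p \<in> M \<longleftrightarrow> M \<in> \<G> - S i"
    proof
      fix i
      have "\<G> - S i \<subseteq> \<M>" using \<G>(1) by blast
      then show "\<exists>p. \<forall>M\<in>\<M>. p \<in> M \<longleftrightarrow> M \<in> \<G> - S i"
        by (intro complete_theories_definable_subset[OF \<M>(2)] complete)
    qed
    then obtain p where p: "\<And>i M. M \<in> \<M> \<Longrightarrow> p i \<in> M \<longleftrightarrow> M \<in> \<G> - S i" by metis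
    have Neg_p: "Neg (p i) \<in> M \<longleftrightarrow> M \<notin> \<G> - S i" if "M \<in> \<M>" for i M
      using p[OF that] complete_theory_Neg[OF complete[OF that]] by simp
    have "Imp (Neg (p i)) (Neg (p j)) \<notin> \<Delta>" if ij: "i \<in> {1..k}" "j \<in> {1..k}" "i \<noteq> j" for i j
    proof
      assume imp: "Imp (Neg (p i)) (Neg (p j)) \<in> \<Delta>"
      have "S i \<noteq> S j" using S(2) ij by (meson inj_onD)
      moreover have "S i \<subseteq> \<G>" "S j \<subseteq> \<G>" "card (S i) = card (S j)" 
        using subsetD[OF S(1) imageI[OF ij(1)]] subsetD[OF S(1) imageI[OF ij(2)]] by auto
      ultimately have "\<not> S i \<subseteq> S j"
        using \<G>(3) by (metis card_subset_eq finite_subset)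
      then obtain M where M: "M \<in> S i" "M \<notin> S j" by blast
      then have "M \<in> \<G>" using \<open>S i \<subseteq> \<G>\<close> by blast
      then have "M \<in> \<M>" using \<G>(1) by blast
      have "Neg (p i) \<in> M" using Neg_p[OF \<open>M \<in> \<M>\<close>] M by blast
      then have "Neg (p j) \<in> M"
        using imp above[OF \<open>M \<in> \<M>\<close>]
          prime_theory_mp[OF complete_theory_prime[OF complete[OF \<open>M \<in> \<M>\<close>]]] by blast
      then show False using Neg_p[OF \<open>M \<in> \<M>\<close>] M \<open>M \<in> \<G>\<close> by blast
    qed
    \<comment> \<open>Only the last disjunct is left, and it fails at \<open>N\<close>, which
      contains every \<open>Neg (p i)\<close>.\<close>
    then have "Neg (foldl Conj (Neg (p 1)) [Neg (p i). i \<leftarrow> [2..<Suc k]]) \<in> \<Delta>"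
      using prime_theory_phi_gt_1[OF k prime phi[of p]] by blast
    then have "foldl Conj (Neg (p 1)) [Neg (p i). i \<leftarrow> [2..<Suc k]] \<notin> N"
      using above[OF N] complete_theory_Neg[OF complete[OF N]] by blast
    moreover have "Neg (p i) \<in> N" for i using Neg_p[OF N] \<G>(1) by blast
    ultimately show False
      by (auto simp: prime_theory_foldl_Conj[OF complete_theory_prime[OF complete[OF N]]])
  qed
qed

section \<open>The Brouwer algebra of upward closed sets\<close>

definition upsets :: "'p::order set \<Rightarrow> 'p set set" where
  "upsets W = {U. U \<subseteq> W \<and> (\<forall>x\<in>U. \<forall>y\<in>W. x \<le> y \<longrightarrow> y \<in> U)}"

text \<open>Renaming along \<open>f\<close> moves the algebra to an arbitrary type that is large enough.\<close>

definition upset_algebra :: "'p::order set \<Rightarrow> ('p set \<Rightarrow> 'a) \<Rightarrow> 'a brouwer" where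
  "upset_algebra W f = (let g = inv_into (upsets W) f in
    \<lparr>carrier = f ` upsets W, eq = (=), le = (\<lambda>a b. g b \<subseteq> g a),
     bimp = (\<lambda>a b. f {x \<in> W. \<forall>y\<in>W. x \<le> y \<longrightarrow> y \<in> g a \<longrightarrow> y \<in> g b}),
     bneg = (\<lambda>a. f {x \<in> W. \<forall>y\<in>W. x \<le> y \<longrightarrow> y \<notin> g a})\<rparr>)"

lemma upsets_Int: "U \<in> upsets W \<Longrightarrow> V \<in> upsets W \<Longrightarrow> U \<inter> V \<in> upsets W"
  and upsets_Un: "U \<in> upsets W \<Longrightarrow> V \<in> upsets W \<Longrightarrow> U \<union> V \<in> upsets W"
  and upsets_empty: "{} \<in> upsets W"
  and upsets_full: "W \<in> upsets W"
  unfolding upsets_def by auto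

lemma upsets_imp: "{x \<in> W. \<forall>y\<in>W. x \<le> y \<longrightarrow> y \<in> U \<longrightarrow> y \<in> V} \<in> upsets W"
  unfolding upsets_def by (auto intro: order_trans)

lemma finite_upsets: "finite W \<Longrightarrow> finite (upsets W)"
  by (rule finite_subset[of _ "Pow W"]) (auto simp: upsets_def)

locale renamed_upsets =
  fixes W :: "'p::order set" and f :: "'p set \<Rightarrow> 'a"
  assumes inj: "inj_on f (upsets W)"
begin

abbreviation "L \<equiv> upset_algebra W f"

lemma f_inv [simp]: "U \<in> upsets W \<Longrightarrow> inv_into (upsets W) f (f U) = U"
  by (rule inv_into_f_f[OF inj])

lemma carrier_L: "carrier L = f ` upsets W"
  by (simp add: upset_algebra_def Let_def)

lemma f_closed [simp]: "U \<in> upsets W \<Longrightarrow> f U \<in> carrier L"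
  by (simp add: carrier_L)

lemma carrierE: "a \<in> carrier L \<Longrightarrow> (\<And>U. U \<in> upsets W \<Longrightarrow> a = f U \<Longrightarrow> thesis) \<Longrightarrow> thesis"
  by (auto simp: carrier_L)

lemma f_eq_iff: "U \<in> upsets W \<Longrightarrow> V \<in> upsets W \<Longrightarrow> f U = f V \<longleftrightarrow> U = V"
  using inj by (auto dest: inj_onD)

lemma eq_L: "(.=\<^bsub>L\<^esub>) = (=)"
  by (simp add: upset_algebra_def Let_def)

lemma le_iff: "U \<in> upsets W \<Longrightarrow> V \<in> upsets W \<Longrightarrow> f U \<sqsubseteq>\<^bsub>L\<^esub> f V \<longleftrightarrow> V \<subseteq> U"
  by (simp add: upset_algebra_def Let_def)

lemma bimp_f:
  "U \<in> upsets W \<Longrightarrow> V \<in> upsets W \<Longrightarrow>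
    (f U \<leadsto>\<^bsub>L\<^esub> f V) = f {x \<in> W. \<forall>y\<in>W. x \<le> y \<longrightarrow> y \<in> U \<longrightarrow> y \<in> V}"
  by (simp add: upset_algebra_def Let_def)

lemma bneg_f: "U \<in> upsets W \<Longrightarrow> (\<sim>\<^bsub>L\<^esub> (f U)) = f {x \<in> W. \<forall>y\<in>W. x \<le> y \<longrightarrow> y \<notin> U}"
  by (simp add: upset_algebra_def Let_def)

lemma partial_order_L: "partial_order L"
  by unfold_locales (auto simp: eq_L le_iff elim!: carrierE)

interpretation partial_order L
  by (rule partial_order_L)

text \<open>The order is reverse inclusion. Join and meet are determined by the order, so they are
  identified through extremal bounds and uniqueness.\<close>

lemma least_Upper:
  assumes [simp]: "U \<in> upsets W" "V \<in> upsets W"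
  shows "least L (f (U \<inter> V)) (Upper L {f U, f V})"
  by (rule least_UpperI) (auto simp: le_iff upsets_Int Upper_def elim!: carrierE)

lemma greatest_Lower:
  assumes [simp]: "U \<in> upsets W" "V \<in> upsets W"
  shows "greatest L (f (U \<union> V)) (Lower L {f U, f V})"
  by (rule greatest_LowerI) (auto simp: le_iff upsets_Un Lower_def elim!: carrierE)

lemma join_f:
  assumes "U \<in> upsets W" "V \<in> upsets W"
  shows "f U \<squnion>\<^bsub>L\<^esub> f V = f (U \<inter> V)"
  unfolding join_def sup_def
  by (rule some_equality, rule least_Upper[OF assms]) (rule least_unique[OF _ least_Upper[OF assms]])

lemma meet_f:
  assumes "U \<in> upsets W" "V \<in> upsets W"
  shows "f U \<sqinter>\<^bsub>L\<^esub> f V = f (U \<union> V)"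
  unfolding meet_def inf_def
  by (rule some_equality, rule greatest_Lower[OF assms])
    (rule greatest_unique[OF _ greatest_Lower[OF assms]])

lemma least_bottom: "least L (f W) (carrier L)"
  unfolding least_def by (auto simp: upsets_full le_iff upsets_def elim!: carrierE)

lemma greatest_top: "greatest L (f {}) (carrier L)"
  unfolding greatest_def by (auto simp: upsets_empty le_iff elim!: carrierE)

lemma bottom_f: "\<bottom>\<^bsub>L\<^esub> = f W"
  unfolding bottom_def
  by (rule some_equality, rule least_bottom) (rule least_unique[OF _ least_bottom])

lemma top_f: "\<top>\<^bsub>L\<^esub> = f {}"
  unfolding top_def
  by (rule some_equality, rule greatest_top) (rule greatest_unique[OF _ greatest_top])

theorem brouwer_algebra_L: "brouwer_algebra L"
proof unfold_locales
  show "\<exists>x. least L x (carrier L)" using least_bottom by blast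
  show "\<exists>x. greatest L x (carrier L)" using greatest_top by blast
next
  fix a b assume "a \<in> carrier L" "b \<in> carrier L"
  then obtain U V where [simp]: "U \<in> upsets W" "V \<in> upsets W" "a = f U" "b = f V"
    by (metis carrierE)
  show "\<exists>s. least L s (Upper L {a, b})" using least_Upper[of U V] by auto
  show "\<exists>s. greatest L s (Lower L {a, b})" using greatest_Lower[of U V] by auto
  show "(a \<leadsto>\<^bsub>L\<^esub> b) \<in> carrier L" by (simp add: bimp_f upsets_imp)
  show "(\<sim>\<^bsub>L\<^esub> a) = (a \<leadsto>\<^bsub>L\<^esub> \<top>\<^bsub>L\<^esub>)" by (simp add: top_f bneg_f bimp_f upsets_empty)
  fix c assume "c \<in> carrier L"
  then obtain X where [simp]: "X \<in> upsets W" "c = f X" by (metis carrierE)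
  show "a \<sqinter>\<^bsub>L\<^esub> (b \<squnion>\<^bsub>L\<^esub> c) = a \<sqinter>\<^bsub>L\<^esub> b \<squnion>\<^bsub>L\<^esub> (a \<sqinter>\<^bsub>L\<^esub> c)"
    by (simp add: join_f meet_f upsets_Int upsets_Un Un_Int_distrib)
  \<comment> \<open>Upward closure of \<open>X\<close> makes this work: from a point of
    \<open>X\<close> every later \<open>y\<close> is again in \<open>X\<close>.\<close>
  have "U \<inter> X \<subseteq> V \<longleftrightarrow> X \<subseteq> {x \<in> W. \<forall>y\<in>W. x \<le> y \<longrightarrow> y \<in> U \<longrightarrow> y \<in> V}"
    using \<open>X \<in> upsets W\<close> unfolding upsets_def by blast
  then show "b \<sqsubseteq>\<^bsub>L\<^esub> a \<squnion>\<^bsub>L\<^esub> c \<longleftrightarrow> (a \<leadsto>\<^bsub>L\<^esub> b) \<sqsubseteq>\<^bsub>L\<^esub> c"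
    by (simp add: join_f bimp_f le_iff upsets_Int upsets_imp)
qed

text \<open>If two upward closed sets cover \<open>W\<close>, one contains the root and is therefore
  all of \<open>W\<close>.\<close>

lemma meet_irreducible_bottom:
  assumes "r \<in> W" "\<And>x. x \<in> W \<Longrightarrow> r \<le> x"
  shows "meet_irreducible L \<bottom>\<^bsub>L\<^esub>"
  unfolding meet_irreducible_def
proof (intro ballI impI)
  fix a b assume "a \<in> carrier L" "b \<in> carrier L" and eq: "\<bottom>\<^bsub>L\<^esub> = a \<sqinter>\<^bsub>L\<^esub> b"
  then obtain U V where [simp]: "U \<in> upsets W" "V \<in> upsets W" "a = f U" "b = f V"
    by (metis carrierE)
  have "W = U \<union> V" using eq by (simp add: bottom_f meet_f f_eq_iff upsets_full upsets_Un)
  then have "r \<in> U \<or> r \<in> V" using assms(1) by blast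
  moreover have "X = W" if "r \<in> X" "X \<in> upsets W" for X
    using that assms unfolding upsets_def by blast
  ultimately have "U = W \<or> V = W" using \<open>U \<in> upsets W\<close> \<open>V \<in> upsets W\<close> by blast
  then show "\<bottom>\<^bsub>L\<^esub> = a \<or> \<bottom>\<^bsub>L\<^esub> = b" by (auto simp: bottom_f)
qed

text \<open>A nonempty upward closed subset of a finite \<open>W\<close> contains a maximal point
  \<open>x\<close> of \<open>W\<close>, and \<open>{x}\<close> is itself upward closed. As the order
  is reversed, \<open>f {x}\<close> lies above the coatom and must equal it.\<close>

lemma coatoms_subset:
  assumes "finite W"
  shows "coatoms L \<subseteq> (\<lambda>x. f {x}) ` {x \<in> W. \<forall>y\<in>W. x \<le> y \<longrightarrow> x = y}"
proof
  fix c assume c: "c \<in> coatoms L"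
  then have "c \<in> carrier L" unfolding coatoms_def by blast
  then obtain U where U: "U \<in> upsets W" "c = f U" by (rule carrierE)
  have "U \<noteq> {}" using c U by (auto simp: coatoms_def top_f)
  moreover have "finite U" using U(1) assms by (auto simp: upsets_def intro: finite_subset)
  ultimately obtain x where x: "x \<in> U" "\<forall>y\<in>U. x \<le> y \<longrightarrow> x = y"
    using finite_has_maximal by blast
  then have max: "x \<in> W" "\<forall>y\<in>W. x \<le> y \<longrightarrow> x = y" using U(1) unfolding upsets_def by auto
  then have up: "{x} \<in> upsets W" unfolding upsets_def by auto
  then have "f {x} \<in> carrier L - {\<top>\<^bsub>L\<^esub>}" "c \<sqsubseteq>\<^bsub>L\<^esub> f {x}"
    using U x(1) by (auto simp: top_f f_eq_iff upsets_empty le_iff)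
  then have "f {x} = c" using c unfolding coatoms_def by blast
  then show "c \<in> (\<lambda>x. f {x}) ` {x \<in> W. \<forall>y\<in>W. x \<le> y \<longrightarrow> x = y}" using max by blast
qed

end

section \<open>Completeness\<close>

primrec subforms :: "form \<Rightarrow> form set" where
  "subforms (Var i) = {Var i}"
| "subforms (Neg A) = insert (Neg A) (subforms A)"
| "subforms (Conj A B) = insert (Conj A B) (subforms A \<union> subforms B)"
| "subforms (Disj A B) = insert (Disj A B) (subforms A \<union> subforms B)"
| "subforms (Imp A B) = insert (Imp A B) (subforms A \<union> subforms B)"

lemma finite_subforms: "finite (subforms A)"
  by (induction A) simp_all

lemma subforms_refl: "A \<in> subforms A"
  by (cases A) simp_all

lemma subforms_trans: "B \<in> subforms A \<Longrightarrow> C \<in> subforms B \<Longrightarrow> C \<in> subforms A"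
  by (induction A) auto

text \<open>Points are traces on \<open>\<Sigma>\<close>, compared by inclusion of traces, so a
  finite \<open>\<Sigma>\<close> gives a finite frame however many theories there are.\<close>

definition filtration :: "form set \<Rightarrow> form set \<Rightarrow> form set set" where
  "filtration \<Sigma> T = {\<Delta> \<inter> \<Sigma> | \<Delta>. prime_theory \<Delta> \<and> T \<subseteq> \<Delta>}"

lemma filtrationE:
  assumes "x \<in> filtration \<Sigma> T"
  obtains \<Delta> where "prime_theory \<Delta>" "T \<subseteq> \<Delta>" "x = \<Delta> \<inter> \<Sigma>"
  using assms unfolding filtration_def by blast

lemma filtrationI: "prime_theory \<Delta> \<Longrightarrow> T \<subseteq> \<Delta> \<Longrightarrow> \<Delta> \<inter> \<Sigma> \<in> filtration \<Sigma> T"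
  unfolding filtration_def by blast

lemma finite_filtration: "finite \<Sigma> \<Longrightarrow> finite (filtration \<Sigma> T)"
  by (rule finite_subset[of _ "Pow \<Sigma>"]) (auto simp: filtration_def)

text \<open>A theory with maximal trace extends to a complete one, whose trace is no smaller, hence
  equal. Counting complete theories thus bounds the maximal points.\<close>

lemma filtration_maximal_subset:
  "{x \<in> filtration \<Sigma> T. \<forall>y\<in>filtration \<Sigma> T. x \<subseteq> y \<longrightarrow> x = y}
    \<subseteq> (\<lambda>M. M \<inter> \<Sigma>) ` {M. complete_theory M \<and> T \<subseteq> M}"
proof (intro subsetI, elim CollectE conjE)
  fix x assume x: "x \<in> filtration \<Sigma> T" "\<forall>y\<in>filtration \<Sigma> T. x \<subseteq> y \<longrightarrow> x = y"
  obtain \<Delta> where \<Delta>: "prime_theory \<Delta>" "T \<subseteq> \<Delta>" "x = \<Delta> \<inter> \<Sigma>"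
    using x(1) by (rule filtrationE)
  obtain M where M: "complete_theory M" "\<Delta> \<subseteq> M"
    using \<Delta>(1) by (rule prime_theory_extends_to_complete)
  have "T \<subseteq> M" using \<Delta>(2) M(2) by blast
  moreover have "x = M \<inter> \<Sigma>"
    using bspec[OF x(2) filtrationI[OF complete_theory_prime[OF M(1)] \<open>T \<subseteq> M\<close>, of \<Sigma>]] \<Delta>(3) M(2)
    by blast
  ultimately show "x \<in> (\<lambda>M. M \<inter> \<Sigma>) ` {M. complete_theory M \<and> T \<subseteq> M}" using M(1) by blast
qed

lemma filtration_Conj:
  assumes "x \<in> filtration \<Sigma> T" "B \<in> \<Sigma>" "C \<in> \<Sigma>" "Conj B C \<in> \<Sigma>"
  shows "Conj B C \<in> x \<longleftrightarrow> B \<in> x \<and> C \<in> x"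
  using assms(1) by (rule filtrationE) (simp add: assms prime_theory_Conj)

lemma filtration_Disj:
  assumes "x \<in> filtration \<Sigma> T" "B \<in> \<Sigma>" "C \<in> \<Sigma>" "Disj B C \<in> \<Sigma>"
  shows "Disj B C \<in> x \<longleftrightarrow> B \<in> x \<or> C \<in> x"
  using assms(1) by (rule filtrationE) (simp add: assms prime_theory_Disj)

text \<open>Trace inclusion need not come from inclusion of theories; it suffices because
  \<open>Imp B C\<close> itself lies in \<open>\<Sigma>\<close> and persists to \<open>y\<close>.
  Conversely, a prime extension with \<open>B\<close> and without \<open>C\<close> witnesses a
  missing implication.\<close>

lemma filtration_Imp:
  assumes "x \<in> filtration \<Sigma> T" "B \<in> \<Sigma>" "C \<in> \<Sigma>" "Imp B C \<in> \<Sigma>"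
  shows "Imp B C \<in> x \<longleftrightarrow> (\<forall>y\<in>filtration \<Sigma> T. x \<subseteq> y \<longrightarrow> B \<in> y \<longrightarrow> C \<in> y)"
proof
  assume imp: "Imp B C \<in> x"
  show "\<forall>y\<in>filtration \<Sigma> T. x \<subseteq> y \<longrightarrow> B \<in> y \<longrightarrow> C \<in> y"
  proof (intro ballI impI)
    fix y assume "y \<in> filtration \<Sigma> T" and y: "x \<subseteq> y" "B \<in> y"
    from this(1) obtain \<Delta> where \<Delta>: "prime_theory \<Delta>" "T \<subseteq> \<Delta>" "y = \<Delta> \<inter> \<Sigma>"
      by (rule filtrationE)
    have "Imp B C \<in> \<Delta>" "B \<in> \<Delta>" using \<Delta>(3) imp y by auto
    then have "C \<in> \<Delta>" by (rule prime_theory_mp[OF \<Delta>(1)])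
    then show "C \<in> y" using \<Delta>(3) assms(3) by simp
  qed
next
  assume all: "\<forall>y\<in>filtration \<Sigma> T. x \<subseteq> y \<longrightarrow> B \<in> y \<longrightarrow> C \<in> y"
  obtain \<Delta> where \<Delta>: "prime_theory \<Delta>" "T \<subseteq> \<Delta>" "x = \<Delta> \<inter> \<Sigma>"
    using assms(1) by (rule filtrationE)
  show "Imp B C \<in> x"
  proof (rule ccontr)
    assume "Imp B C \<notin> x"
    then have "Imp B C \<notin> \<Delta>" using \<Delta>(3) assms(4) by blast
    then obtain \<Delta>' where \<Delta>': "prime_theory \<Delta>'" "\<Delta> \<subseteq> \<Delta>'" "B \<in> \<Delta>'" "C \<notin> \<Delta>'"
      by (rule prime_theory_not_Imp[OF \<Delta>(1)])
    have mem: "\<Delta>' \<inter> \<Sigma> \<in> filtration \<Sigma> T" by (rule filtrationI[OF \<Delta>'(1) order_trans[OF \<Delta>(2) \<Delta>'(2)]])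
    have sub: "x \<subseteq> \<Delta>' \<inter> \<Sigma>" "B \<in> \<Delta>' \<inter> \<Sigma>" "C \<notin> \<Delta>' \<inter> \<Sigma>"
      using \<Delta>(3) \<Delta>'(2-4) assms(2) by auto
    show False using all[rule_format, OF mem sub(1,2)] sub(3) by contradiction
  qed
qed

lemma filtration_Neg:
  assumes "x \<in> filtration \<Sigma> T" "B \<in> \<Sigma>" "Neg B \<in> \<Sigma>"
  shows "Neg B \<in> x \<longleftrightarrow> (\<forall>y\<in>filtration \<Sigma> T. x \<subseteq> y \<longrightarrow> B \<notin> y)"
proof
  assume neg: "Neg B \<in> x"
  show "\<forall>y\<in>filtration \<Sigma> T. x \<subseteq> y \<longrightarrow> B \<notin> y"
  proof (intro ballI impI)
    fix y assume "y \<in> filtration \<Sigma> T" and y: "x \<subseteq> y"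
    from this(1) obtain \<Delta> where \<Delta>: "prime_theory \<Delta>" "T \<subseteq> \<Delta>" "y = \<Delta> \<inter> \<Sigma>"
      by (rule filtrationE)
    have "Neg B \<in> \<Delta>" using \<Delta>(3) neg y by auto
    then show "B \<notin> y" using prime_theory_consistent[OF \<Delta>(1)] \<Delta>(3) by auto
  qed
next
  assume all: "\<forall>y\<in>filtration \<Sigma> T. x \<subseteq> y \<longrightarrow> B \<notin> y"
  obtain \<Delta> where \<Delta>: "prime_theory \<Delta>" "T \<subseteq> \<Delta>" "x = \<Delta> \<inter> \<Sigma>"
    using assms(1) by (rule filtrationE)
  show "Neg B \<in> x"
  proof (rule ccontr)
    assume "Neg B \<notin> x"
    then have "Neg B \<notin> \<Delta>" using \<Delta>(3) assms(3) by blast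
    then obtain \<Delta>' where \<Delta>': "complete_theory \<Delta>'" "\<Delta> \<subseteq> \<Delta>'" "B \<in> \<Delta>'"
      by (rule prime_theory_not_Neg[OF \<Delta>(1)])
    have mem: "\<Delta>' \<inter> \<Sigma> \<in> filtration \<Sigma> T"
      by (rule filtrationI[OF complete_theory_prime[OF \<Delta>'(1)] order_trans[OF \<Delta>(2) \<Delta>'(2)]])
    have sub: "x \<subseteq> \<Delta>' \<inter> \<Sigma>" "B \<in> \<Delta>' \<inter> \<Sigma>"
      using \<Delta>(3) \<Delta>'(2,3) assms(2) by auto
    show False using all[rule_format, OF mem sub(1)] sub(2) by contradiction
  qed
qed

lemma upsets_filtration: "{x \<in> filtration \<Sigma> T. B \<in> x} \<in> upsets (filtration \<Sigma> T)"
  unfolding upsets_def by auto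

text \<open>The truth lemma; the induction stays among subformulas of \<open>A\<close> because the
  clauses for connectives require membership in \<open>\<Sigma>\<close>.\<close>

lemma eval_filtration:
  assumes "inj_on f (upsets (filtration (subforms A) T))" "B \<in> subforms A"
  shows "eval (upset_algebra (filtration (subforms A) T) f)
      (\<lambda>i. f {x \<in> filtration (subforms A) T. Var i \<in> x}) B
    = f {x \<in> filtration (subforms A) T. B \<in> x}"
  using assms(2)
proof (induction B)
  case (Var i)
  then show ?case by simp
next
  case (Neg B)
  interpret renamed_upsets "filtration (subforms A) T" f by unfold_locales (rule assms(1))
  have sub: "B \<in> subforms A"
    using Neg.prems by (rule subforms_trans) (simp add: subforms_refl)
  show ?case
    by (simp add: Neg.IH[OF sub] bneg_f upsets_filtration filtration_Neg[OF _ sub Neg.prems]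
        cong: conj_cong)
next
  case (Conj B C)
  interpret renamed_upsets "filtration (subforms A) T" f by unfold_locales (rule assms(1))
  have sub: "B \<in> subforms A" "C \<in> subforms A"
    using Conj.prems by (rule subforms_trans, simp add: subforms_refl)+
  show ?case
    by (simp add: Conj.IH sub join_f upsets_filtration, rule arg_cong[of _ _ f])
      (auto simp: filtration_Conj[OF _ sub Conj.prems])
next
  case (Disj B C)
  interpret renamed_upsets "filtration (subforms A) T" f by unfold_locales (rule assms(1))
  have sub: "B \<in> subforms A" "C \<in> subforms A"
    using Disj.prems by (rule subforms_trans, simp add: subforms_refl)+
  show ?case
    by (simp add: Disj.IH sub meet_f upsets_filtration, rule arg_cong[of _ _ f])
      (auto simp: filtration_Disj[OF _ sub Disj.prems])
next
  case (Imp B C)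
  interpret renamed_upsets "filtration (subforms A) T" f by unfold_locales (rule assms(1))
  have sub: "B \<in> subforms A" "C \<in> subforms A"
    using Imp.prems by (rule subforms_trans, simp add: subforms_refl)+
  show ?case
    by (simp add: Imp.IH sub bimp_f upsets_filtration filtration_Imp[OF _ sub Imp.prems]
        cong: conj_cong)
qed

section \<open>The finite countermodel and the two directions of the theorem\<close>

theorem exists_countermodel:
  assumes "k \<ge> 1" "n \<ge> 1" "k \<le> n choose (n div 2)" "A \<notin> IPC_plus (phi k)"
  shows "\<exists>L :: ('a::infinite) brouwer. brouwer_algebra L \<and> finite (carrier L) \<and>
    meet_irreducible L \<bottom>\<^bsub>L\<^esub> \<and> card (coatoms L) \<le> n \<and> \<not> satisfies L A"
proof -
  obtain T where T: "prime_theory T" "range (\<lambda>s. subst s (phi k)) \<subseteq> T" "A \<notin> T"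
  proof -
    have "\<not> range (\<lambda>s. subst s (phi k)) \<turnstile>\<^sub>I A" using assms(4) unfolding IPC_plus_def by simp
    then show thesis by (rule exists_prime_theory_maximal) (rule that)
  qed
  define W where "W = filtration (subforms A) T"
  let ?C = "{M. complete_theory M \<and> T \<subseteq> M}"
  have finW: "finite W" unfolding W_def by (intro finite_filtration finite_subforms)
  have r: "T \<inter> subforms A \<in> W" unfolding W_def using T(1) by (rule filtrationI) simp
  have root: "T \<inter> subforms A \<subseteq> x" if "x \<in> W" for x
    using that unfolding W_def by (rule filtrationE) blast
  \<comment> \<open>An infinite type has finite subsets of every size, which gives room for a copy
    of the finite algebra.\<close>
  obtain F :: "'a set" where F: "finite F" "card F = card (upsets W)"
    using infinite_arbitrarily_large[OF infinite_UNIV] by blast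
  then obtain f :: "form set set \<Rightarrow> 'a" where f: "inj_on f (upsets W)"
    using card_le_inj[OF finite_upsets[OF finW], of F] by auto
  interpret renamed_upsets W f by unfold_locales (rule f)
  have C: "finite ?C" "card ?C \<le> n"
    using complete_theories_above_bound[OF assms(1-3) T(1)] T(2) by auto
  let ?max = "{x \<in> W. \<forall>y\<in>W. x \<subseteq> y \<longrightarrow> x = y}"
  \<comment> \<open>Coatoms are bounded by maximal points, these by traces of complete theories
    above \<open>T\<close>, and those by \<open>n\<close>.\<close>
  have "card (coatoms L) \<le> card ((\<lambda>x. f {x}) ` ?max)"
    using finW by (intro card_mono coatoms_subset) auto
  also have "\<dots> \<le> card ?max" by (rule card_image_le) (use finW in simp)
  also have "\<dots> \<le> card ((\<lambda>M. M \<inter> subforms A) ` ?C)"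
    unfolding W_def by (intro card_mono filtration_maximal_subset finite_imageI C(1))
  also have "\<dots> \<le> card ?C" by (rule card_image_le[OF C(1)])
  finally have few: "card (coatoms L) \<le> n" using C(2) by simp
  let ?v = "\<lambda>i. f {x \<in> W. Var i \<in> x}"
  have up: "{x \<in> W. B \<in> x} \<in> upsets W" for B unfolding W_def by (rule upsets_filtration)
  have "eval L ?v A = f {x \<in> W. A \<in> x}"
    using eval_filtration[of f A T A, folded W_def, OF f subforms_refl] .
  \<comment> \<open>The root omits \<open>A\<close>, so the value of \<open>A\<close> is not the
    full set, which is the least element.\<close>
  moreover have "T \<inter> subforms A \<notin> {x \<in> W. A \<in> x}" using T(3) by simp
  then have "{x \<in> W. A \<in> x} \<noteq> W" using r by metis
  ultimately have "eval L ?v A \<noteq> \<bottom>\<^bsub>L\<^esub>" by (simp add: bottom_f f_eq_iff up upsets_full)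
  moreover have "\<forall>i. ?v i \<in> carrier L" using up by simp
  ultimately have "\<not> satisfies L A"
    unfolding satisfies_def not_all not_imp by (intro exI[of _ ?v] HOL.conjI)
  moreover have "finite (carrier L)" by (simp add: carrier_L finite_upsets finW)
  ultimately show ?thesis
    using brouwer_algebra_L meet_irreducible_bottom[OF r root] few by (intro exI[of _ L] HOL.conjI)
qed

lemma (in brouwer_algebra) satisfies_IPC_plus_phi:
  assumes "finite (carrier L)" "card (coatoms L) \<le> n"
    and "k \<ge> 1" "n = (LEAST m. m \<ge> 1 \<and> m choose (m div 2) \<ge> k)"
    and "A \<in> IPC_plus (phi k)"
  shows "satisfies L A"
proof -
  have phi: "eval L v (phi k) = \<bottom>" if v: "\<And>i. v i \<in> carrier L" for v :: "nat \<Rightarrow> 'a"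
  proof (cases "k = 1")
    case True
    \<comment> \<open>The clause \<open>m \<ge> 1\<close> matters here, as \<open>0 choose 0\<close>
      is already \<open>1\<close>.\<close>
    have "n = 1" unfolding assms(4) True by (rule Least_equality) auto
    then show ?thesis using eval_phi_1[OF assms(1) _ v] assms(2) True by simp
  next
    case False
    then have k: "k > 1" using assms(3) by simp
    have "m choose (m div 2) < k" if "m < card (coatoms L)" for m
    \<comment> \<open>Leastness is silent about \<open>m = 0\<close>, where the coefficient is
      \<open>1\<close>, below \<open>k\<close>.\<close>
    proof (cases "m = 0")
      case False
      then show ?thesis
        using not_less_Least[of m "\<lambda>m. m \<ge> 1 \<and> m choose (m div 2) \<ge> k"] that assms(2,4) by simp
    qed (use k in simp)
    then show ?thesis by (rule eval_phi_gt_1[OF k assms(1) _ v])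
  qed
  show ?thesis unfolding satisfies_def
  proof (intro allI impI)
    fix v :: "nat \<Rightarrow> 'a" assume v: "\<forall>i. v i \<in> carrier L"
    show "eval L v A = \<bottom>"
    proof (rule ipc_soundness)
      show "range (\<lambda>s. subst s (phi k)) \<turnstile>\<^sub>I A" using assms(5) unfolding IPC_plus_def by simp
      show "v i \<in> carrier L" for i using v ..
      fix B assume "B \<in> range (\<lambda>s. subst s (phi k))"
      then obtain s where "B = subst s (phi k)" by blast
      then show "eval L v B = \<bottom>" using v by (simp add: eval_subst phi eval_closed)
    qed
  qed
qed

theorem theorem3p3:
  fixes k n :: nat and A :: form
  assumes "k \<ge> 1"
    and "n = (LEAST m. m \<ge> 1 \<and> m choose (m div 2) \<ge> k)"
  shows "A \<in> IPC_plus (phi k) \<longleftrightarrow>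
    (\<forall>L :: ('a::infinite) brouwer.
       brouwer_algebra L \<and> finite (carrier L) \<and> meet_irreducible L \<bottom>\<^bsub>L\<^esub> \<and> card (coatoms L) \<le> n
       \<longrightarrow> satisfies L A)"
proof
  assume "A \<in> IPC_plus (phi k)"
  then show "\<forall>L :: 'a brouwer.
       brouwer_algebra L \<and> finite (carrier L) \<and> meet_irreducible L \<bottom>\<^bsub>L\<^esub> \<and> card (coatoms L) \<le> n
       \<longrightarrow> satisfies L A"
    using brouwer_algebra.satisfies_IPC_plus_phi[OF _ _ _ assms] by blast
next
  \<comment> \<open>The least value is attained because \<open>k\<close> itself qualifies:
    \<open>k choose 1 = k\<close> is at most the central coefficient.\<close>
  have "k \<ge> 1 \<and> k choose (k div 2) \<ge> k"
    using assms(1) binomial_maximum[of k 1] by simp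
  then have "n \<ge> 1 \<and> n choose (n div 2) \<ge> k"
    unfolding assms(2) by (rule LeastI)
  moreover assume "\<forall>L :: 'a brouwer.
       brouwer_algebra L \<and> finite (carrier L) \<and> meet_irreducible L \<bottom>\<^bsub>L\<^esub> \<and> card (coatoms L) \<le> n
       \<longrightarrow> satisfies L A"
  ultimately show "A \<in> IPC_plus (phi k)"
    using exists_countermodel[OF assms(1), of n A] by blast
qed

end
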